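(* A complete extended pseudometric space is a Baire space.
   Context: An extended pseudometric on a set $X$ is a map $d:X\times X\to[0,\infty]$ with $d(x,x)=0$, $d(x,y)=d(y,x)$ and $d(x,y)\le d(x,z)+d(z,y)$ for all $x,y,z\in X$; the induced topology has the open balls $B_r(x)=\{y: d(x,y)<r\}$, $r>0$, as a base. The space is complete if every Cauchy sequence converges to some point of $X$ (limits need not be unique). A subset $A\subset X$ has empty interior if it contains no nonempty open set of $X$. A topological space $X$ is a Baire space if for any countable collection of closed sets in $X$ each with empty interior in $X$, their union also has empty interior in $X$. *)

theory Defs
  imports "HOL-Analysis.Analysis"
begin

text \<open>
  The carrier is a set \<open>X\<close>, as in the library locale \<open>Metric_space\<close>; the values of
  \<open>d\<close> outside \<open>X\<close> are irrelevant. The type \<^typ>\<open>ennreal\<close> is $[0,\infty]$.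
\<close>

locale extended_pseudometric =
  fixes X :: "'a set" and d :: "'a \<Rightarrow> 'a \<Rightarrow> ennreal"
  assumes self: "x \<in> X \<Longrightarrow> d x x = 0"
    and commute: "\<lbrakk>x \<in> X; y \<in> X\<rbrakk> \<Longrightarrow> d x y = d y x"
    and triangle: "\<lbrakk>x \<in> X; y \<in> X; z \<in> X\<rbrakk> \<Longrightarrow> d x y \<le> d x z + d z y"
begin

definition eball :: "'a \<Rightarrow> real \<Rightarrow> 'a set"
  where "eball x r = {y \<in> X. d x y < ennreal r}"

definition etopology :: "'a topology"
  where "etopology =
    topology (arbitrary union_of (\<lambda>B. \<exists>x\<in>X. \<exists>r>0. B = eball x r))"

definition ECauchy :: "(nat \<Rightarrow> 'a) \<Rightarrow> bool"
  where "ECauchy \<sigma> \<longleftrightarrow> range \<sigma> \<subseteq> X \<and>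
    (\<forall>\<epsilon>::real. \<epsilon> > 0 \<longrightarrow> (\<exists>N. \<forall>m\<ge>N. \<forall>n\<ge>N. d (\<sigma> m) (\<sigma> n) < ennreal \<epsilon>))"

definition ecomplete :: bool
  where "ecomplete \<longleftrightarrow>
    (\<forall>\<sigma>. ECauchy \<sigma> \<longrightarrow> (\<exists>x. limitin etopology \<sigma> x sequentially))"

lemma eball_shrink:
  assumes "x \<in> X" "z \<in> eball x r"
  obtains s where "0 < s" "eball z s \<subseteq> eball x r"
proof -
  have z: "z \<in> X" "d x z < ennreal r" using assms by (auto simp: eball_def)
  then obtain t where t: "0 \<le> t" "d x z = ennreal t"
    by (cases "d x z") auto
  have tr: "t < r" using z t ennreal_less_iff by auto
  show thesis
  proof
    show "0 < r - t" using tr by simp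
    show "eball z (r - t) \<subseteq> eball x r"
    proof
      fix y assume "y \<in> eball z (r - t)"
      then have y: "y \<in> X" "d z y < ennreal (r - t)" by (auto simp: eball_def)
      then obtain u where u: "0 \<le> u" "d z y = ennreal u"
        by (cases "d z y") auto
      have "u < r - t" using y u ennreal_less_iff by auto
      have "d x y \<le> d x z + d z y" using triangle assms z y by blast
      also have "\<dots> = ennreal (t + u)" using t u by simp
      also have "\<dots> < ennreal r" using \<open>u < r - t\<close> t u by (intro ennreal_lessI) auto
      finally show "y \<in> eball x r" using y by (simp add: eball_def)
    qed
  qed
qed

lemma centre_in_eball: "\<lbrakk>x \<in> X; 0 < r\<rbrakk> \<Longrightarrow> x \<in> eball x r"
  by (simp add: eball_def self)

text \<open>The balls do form a base, so \<^const>\<open>etopology\<close> is the topology it is meant to be.\<close>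

lemma istopology_eballs:
  "istopology (arbitrary union_of (\<lambda>B. \<exists>x\<in>X. \<exists>r>0. B = eball x r))"
proof (subst istopology_base_eq, intro allI impI, elim conjE)
  fix S T :: "'a set"
  assume "\<exists>x\<in>X. \<exists>r>0. S = eball x r" "\<exists>x\<in>X. \<exists>r>0. T = eball x r"
  then obtain x r y s where *: "x \<in> X" "S = eball x r" "y \<in> X" "T = eball y s"
    by blast
  have "\<exists>U. (\<exists>x\<in>X. \<exists>r>0. U = eball x r) \<and> z \<in> U \<and> U \<subseteq> S \<inter> T"
    if z: "z \<in> S \<inter> T" for z :: 'a
  proof -
    have zX: "z \<in> X" using z * by (auto simp: eball_def)
    obtain a where a: "0 < a" "eball z a \<subseteq> S" using eball_shrink z * by blast
    obtain b where b: "0 < b" "eball z b \<subseteq> T" using eball_shrink z * by blast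
    have "eball z (min a b) \<subseteq> eball z a" "eball z (min a b) \<subseteq> eball z b"
      using a b by (auto simp: eball_def intro: less_le_trans ennreal_leI)
    then have "z \<in> eball z (min a b) \<and> eball z (min a b) \<subseteq> S \<inter> T"
      using a b zX by (auto intro: centre_in_eball)
    moreover have "0 < min a b" using a b by simp
    ultimately show ?thesis using zX by blast
  qed
  then show "(arbitrary union_of (\<lambda>B. \<exists>x\<in>X. \<exists>r>0. B = eball x r)) (S \<inter> T)"
    unfolding arbitrary_union_of_alt by blast
qed

lemma openin_etopology:
  "openin etopology U \<longleftrightarrow> U \<subseteq> X \<and> (\<forall>x\<in>U. \<exists>r>0. eball x r \<subseteq> U)"
  (is "?L \<longleftrightarrow> ?R")
proof -
  have L: "?L \<longleftrightarrow>
      (\<forall>z\<in>U. \<exists>B. (\<exists>x\<in>X. \<exists>r>0. B = eball x r) \<and> z \<in> B \<and> B \<subseteq> U)"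
    by (simp add: etopology_def topology_inverse'[OF istopology_eballs] arbitrary_union_of_alt)
  show ?thesis
  proof
    assume ?L
    show ?R
    proof (intro conjI ballI subsetI)
      fix z assume "z \<in> U"
      then obtain x r where x: "x \<in> X" "z \<in> eball x r" "eball x r \<subseteq> U"
        using \<open>?L\<close> L by blast
      then show "z \<in> X" by (simp add: eball_def)
      show "\<exists>r>0. eball z r \<subseteq> U" using eball_shrink x by (metis subset_trans)
    qed
  next
    assume ?R
    then show ?L unfolding L using centre_in_eball by blast
  qed
qed

lemma topspace_etopology: "topspace etopology = X"
proof
  show "topspace etopology \<subseteq> X"
    using openin_etopology openin_topspace by blast
  have "openin etopology X"
    unfolding openin_etopology by (auto simp: eball_def intro: exI[of _ 1])
  then show "X \<subseteq> topspace etopology" by (rule openin_subset)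
qed

end

definition Baire_space :: "'a topology \<Rightarrow> bool"
  where "Baire_space T \<longleftrightarrow>
    (\<forall>\<C>. countable \<C> \<longrightarrow> (\<forall>C\<in>\<C>. closedin T C \<and> T interior_of C = {}) \<longrightarrow>
      T interior_of (\<Union>\<C>) = {})"

end

theory Submission
  imports Defs
begin

text \<open>
  This is the nested-ball proof of the Baire category theorem. Suppose that a union of closed sets
  \<open>c n\<close> with empty interior contains a ball. Inside it one builds balls of radii tending to \<open>0\<close>,
  each inside the previous one, such that the doubled \<open>n+1\<close>-st ball misses \<open>c n\<close>
  (\<open>ball_avoiding_closed_set\<close>, \<open>nested_balls_avoiding_closed_sets\<close>). The centres form a Cauchy
  sequence, and a limit of it lies in all the doubled balls (\<open>nested_balls_common_point\<close>); so it
  lies in none of the \<open>c n\<close>, although it lies in the ball at the start.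

  The whole construction takes place inside balls of finite radius, so the value \<open>\<infinity>\<close> is never met,
  and the argument holds for every limit of the centres. Doubled radii play the part that closed
  balls have in the usual argument: the triangle inequality puts a limit of points of a ball into
  the doubled ball.
\<close>

context extended_pseudometric
begin

lemma eball_mono: "r \<le> s \<Longrightarrow> eball x r \<subseteq> eball x s"
  by (auto simp: eball_def intro: less_le_trans ennreal_leI)

lemma openin_eball: "x \<in> X \<Longrightarrow> openin etopology (eball x r)"
  unfolding openin_etopology using eball_shrink[of x _ r] by (metis eball_def mem_Collect_eq subsetI)

lemma eball_double_triangle:
  assumes "x \<in> X" "y \<in> X" "z \<in> X" "d x z < ennreal r" "d z y < ennreal r" "r > 0"
  shows "d x y < ennreal (2 * r)"
proof -
  have "d x y \<le> d x z + d z y"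
    using assms by (intro triangle)
  also have "\<dots> < ennreal r + ennreal r"
    using assms by (intro add_strict_mono)
  also have "\<dots> = ennreal (2 * r)"
    using assms by (simp flip: ennreal_plus)
  finally show ?thesis .
qed

text \<open>
  The ball is open and nonempty, so a closed set with empty interior cannot contain it, and the rest
  of the ball is again open and nonempty. Halving the radius of a ball found there leaves room for the doubled ball.
\<close>

lemma ball_avoiding_closed_set:
  assumes C: "closedin etopology C" "etopology interior_of C = {}"
    and x: "x \<in> X" "r > 0" and e: "e > 0"
  shows "\<exists>y\<in>X. \<exists>s>0. s \<le> e \<and> eball y (2 * s) \<subseteq> eball x r - C"
proof -
  have "\<not> eball x r \<subseteq> C"
    using interior_of_maximal[OF _ openin_eball[OF x(1)]] C(2) centre_in_eball[OF x] by blast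
  then obtain y where y: "y \<in> eball x r - C" by blast
  have "openin etopology (eball x r - C)"
    using C(1) openin_eball x by blast
  then obtain t where t: "t > 0" "eball y t \<subseteq> eball x r - C"
    using y unfolding openin_etopology by blast
  show ?thesis
  proof (intro bexI exI conjI)
    show "0 < min e (t / 2)" "min e (t / 2) \<le> e" using t e by auto
    have "eball y (2 * min e (t / 2)) \<subseteq> eball y t"
      by (rule eball_mono) simp
    then show "eball y (2 * min e (t / 2)) \<subseteq> eball x r - C" using t by blast
    show "y \<in> X" using y by (simp add: eball_def)
  qed
qed

lemma nested_balls_avoiding_closed_sets:
  fixes c :: "nat \<Rightarrow> 'a set"
  assumes c: "\<And>n. closedin etopology (c n)" "\<And>n. etopology interior_of (c n) = {}"
    and x: "x \<in> X" "r > 0"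
  shows "\<exists>y s. y 0 = x \<and> s 0 = r \<and> (\<forall>n. y n \<in> X \<and> s n > 0 \<and> s (Suc n) \<le> 1 / Suc n
    \<and> eball (y (Suc n)) (2 * s (Suc n)) \<subseteq> eball (y n) (s n) - c n)"
proof -
  \<comment> \<open>A pair is a centre with a radius; the last conjunct pins the ball at the start.\<close>
  let ?P = "\<lambda>n p. fst p \<in> X \<and> snd p > 0 \<and> (n = 0 \<longrightarrow> p = (x, r))"
  let ?Q = "\<lambda>n p q. snd q \<le> 1 / Suc n
    \<and> eball (fst q) (2 * snd q) \<subseteq> eball (fst p) (snd p) - c n"
  have "\<exists>f. \<forall>n. ?P n (f n) \<and> ?Q n (f n) (f (Suc n))"
  proof (rule dependent_nat_choice)
    show "\<exists>p. ?P 0 p" using x by auto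
    fix p :: "'a \<times> real" and n :: nat
    assume "?P n p"
    then obtain y s where "y \<in> X" "s > 0" "s \<le> 1 / Suc n"
      "eball y (2 * s) \<subseteq> eball (fst p) (snd p) - c n"
      using ball_avoiding_closed_set[OF c[of n], of "fst p" "snd p" "1 / Suc n"]
      by (metis of_nat_0_less_iff zero_less_Suc zero_less_divide_1_iff)
    then show "\<exists>q. ?P (Suc n) q \<and> ?Q n p q"
      by (intro exI[of _ "(y, s)"]) simp
  qed
  then obtain f where f: "?P n (f n)" "?Q n (f n) (f (Suc n))" for n
    by blast
  show ?thesis
  proof (intro exI conjI allI)
    show "fst (f 0) = x" "snd (f 0) = r" using f(1)[of 0] by simp_all
  qed (use f in blast)+
qed

text \<open>
  From the index \<open>n\<close> on all centres lie in the \<open>n\<close>-th ball, hence within twice its radius of each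
  other. This gives the Cauchy property. A centre of large index is also within that radius of the
  limit, which is therefore in the doubled \<open>n\<close>-th ball.
\<close>

lemma nested_balls_common_point:
  assumes ecomplete and y: "\<And>n. y n \<in> X" and s: "\<And>n. s n > 0" "s \<longlonglongrightarrow> 0"
    and nest: "\<And>n. eball (y (Suc n)) (s (Suc n)) \<subseteq> eball (y n) (s n)"
  shows "\<exists>z. \<forall>n. z \<in> eball (y n) (2 * s n)"
proof -
  have near: "d (y n) (y m) < ennreal (s n)" if "n \<le> m" for n m
  proof -
    have "eball (y m) (s m) \<subseteq> eball (y n) (s n)"
      using nest that by (rule lift_Suc_antimono_le)
    then show ?thesis
      using centre_in_eball[OF y s(1), of m m] by (auto simp: eball_def)
  qed
  have "ECauchy y"
    unfolding ECauchy_def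
  proof (intro conjI allI impI)
    show "range y \<subseteq> X" using y by blast
    fix \<epsilon> :: real assume "\<epsilon> > 0"
    then have "\<forall>\<^sub>F n in sequentially. s n < \<epsilon> / 2"
      using s(2) by (intro order_tendstoD) auto
    then obtain N where N: "s N < \<epsilon> / 2"
      by (auto simp: eventually_sequentially)
    have "d (y m) (y n) < ennreal \<epsilon>" if "N \<le> m" "N \<le> n" for m n
    proof -
      have "d (y m) (y n) < ennreal (2 * s N)"
        using near that y s(1) commute by (intro eball_double_triangle[of _ _ "y N"]) auto
      also have "\<dots> \<le> ennreal \<epsilon>" using N by (intro ennreal_leI) simp
      finally show ?thesis .
    qed
    then show "\<exists>N. \<forall>m\<ge>N. \<forall>n\<ge>N. d (y m) (y n) < ennreal \<epsilon>" by blast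
  qed
  then obtain z where z: "limitin etopology y z sequentially"
    using \<open>ecomplete\<close> unfolding ecomplete_def by blast
  then have zX: "z \<in> X" by (simp add: limitin_def topspace_etopology)
  have "z \<in> eball (y n) (2 * s n)" for n
  proof -
    have "\<forall>\<^sub>F m in sequentially. y m \<in> eball z (s n)"
      using z zX openin_eball centre_in_eball s(1) by (simp add: limitin_def)
    then have "\<forall>\<^sub>F m in sequentially. n \<le> m \<and> y m \<in> eball z (s n)"
      using eventually_ge_at_top eventually_conj by blast
    then obtain m where m: "n \<le> m" "y m \<in> eball z (s n)"
      using eventually_happens'[OF sequentially_bot] by blast
    then have "d (y m) z < ennreal (s n)"
      using commute[OF y zX] by (simp add: eball_def)
    then have "d (y n) z < ennreal (2 * s n)"
      using near[OF m(1)] y zX s(1) by (intro eball_double_triangle[of _ _ "y m"])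
    then show ?thesis using zX by (simp add: eball_def)
  qed
  then show ?thesis by blast
qed

lemma interior_of_Union_closed_sets_empty:
  fixes c :: "nat \<Rightarrow> 'a set"
  assumes ecomplete
    and c: "\<And>n. closedin etopology (c n)" "\<And>n. etopology interior_of (c n) = {}"
  shows "etopology interior_of (\<Union>n. c n) = {}"
proof (rule ccontr)
  assume "etopology interior_of (\<Union>n. c n) \<noteq> {}"
  then obtain x where x: "x \<in> etopology interior_of (\<Union>n. c n)" by blast
  have "openin etopology (etopology interior_of (\<Union>n. c n))" by simp
  then obtain r where r: "x \<in> X" "r > 0" "eball x r \<subseteq> (\<Union>n. c n)"
    using x interior_of_subset unfolding openin_etopology by (meson subset_iff)
  obtain y s where ys: "y 0 = x" "s 0 = r" "\<And>n. y n \<in> X" "\<And>n. s n > 0"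
    "\<And>n. s (Suc n) \<le> 1 / Suc n"
    "\<And>n. eball (y (Suc n)) (2 * s (Suc n)) \<subseteq> eball (y n) (s n) - c n"
    using nested_balls_avoiding_closed_sets[of c, OF c r(1,2)] by blast
  have "(\<lambda>n. s (Suc n)) \<longlonglongrightarrow> 0"
  proof (rule tendsto_sandwich[OF _ _ tendsto_const LIMSEQ_Suc[OF lim_1_over_n]])
    show "\<forall>\<^sub>F n in sequentially. 0 \<le> s (Suc n)"
      using ys(4) by (intro always_eventually allI less_imp_le)
    show "\<forall>\<^sub>F n in sequentially. s (Suc n) \<le> 1 / real (Suc n)"
      using ys(5) by (intro always_eventually allI)
  qed
  then have lim: "s \<longlonglongrightarrow> 0" by (rule LIMSEQ_imp_Suc)
  have "eball (y (Suc n)) (s (Suc n)) \<subseteq> eball (y n) (s n)" for n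
    using eball_mono[of "s (Suc n)" "2 * s (Suc n)" "y (Suc n)"] ys(4)[of "Suc n"] ys(6)[of n]
    by force
  then obtain z where z: "\<And>n. z \<in> eball (y n) (2 * s n)"
    using nested_balls_common_point[of y s, OF \<open>ecomplete\<close> ys(3,4) lim] by blast
  have *: "z \<in> eball (y n) (s n) - c n" for n
    using z ys(6) by (rule subsetD[rotated])
  then have "z \<notin> c n" for n by blast
  moreover have "z \<in> eball x r" using *[of 0] unfolding ys(1,2) by blast
  ultimately show False using r(3) by blast
qed

end

theorem theorem4p35:
  fixes X :: "'a set" and d :: "'a \<Rightarrow> 'a \<Rightarrow> ennreal"
  assumes "extended_pseudometric X d"
    and "extended_pseudometric.ecomplete X d"
  shows "Baire_space (extended_pseudometric.etopology X d)"
proof -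
  interpret extended_pseudometric X d by fact
  show ?thesis
    unfolding Baire_space_def
  proof (intro allI impI)
    fix \<C> :: "'a set set"
    assume \<C>: "countable \<C>" "\<forall>C\<in>\<C>. closedin etopology C \<and> etopology interior_of C = {}"
    show "etopology interior_of (\<Union>\<C>) = {}"
    \<comment> \<open>Only a nonempty countable family is the range of a sequence.\<close>
    proof (cases "\<C> = {}")
      case False
      then have "range (from_nat_into \<C>) = \<C>"
        using \<C>(1) by (rule range_from_nat_into)
      then show ?thesis
        using interior_of_Union_closed_sets_empty[OF assms(2), of "from_nat_into \<C>"] \<C>(2) False
        by (simp add: from_nat_into)
    qed simp
  qed
qed

end
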